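(* Let $L$ be the countable first-order language expanding the language of ordered sets by constants for all rational numbers in $[0,1]$ and by function symbols for the five operations $T_G,T_L,T_P,T_{NM},T_D$. Let $M$ be the corresponding $L$-structure with universe $[0,1]$, let $\mathcal V$ be a non-principal ultrafilter on $\mathbb N$, and assume that the ultrapower ${}^{\ast}M=M^{\mathbb N}/\mathcal V$ is $\aleph_1$-saturated. Let $\Sigma(\bar x)$ be a countable set of $L$-formulas in variables $\bar x=(x_1,\dots,x_m)$. (Near $1$) Assume that for every finite $\Sigma_0\subseteq\Sigma$ and every integer $k\ge2$ there exists $\bar a\in(1-\tfrac1k,1)^m$ such that $M\models\bigwedge_{\varphi\in\Sigma_0}\varphi(\bar a)$. Then there exists $\bar\xi=(\xi_1,\dots,\xi_m)\in\mu^-(1)^m$ such that ${}^{\ast}M\models\varphi(\bar\xi)$ for every $\varphi\in\Sigma$. (Near $0$) Assume that for every finite $\Sigma_0\subseteq\Sigma$ and every integer $k\ge2$ there exists $\bar a\in(0,\tfrac1k)^m$ such that $M\models\bigwedge_{\varphi\in\Sigma_0}\varphi(\bar a)$. Then there exists $\bar\xi\in\mu^+(0)^m$ such that ${}^{\ast}M\models\varphi(\bar\xi)$ for every $\varphi\in\Sigma$.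
   Context: The operations $[0,1]^2\to[0,1]$ interpreting the function symbols are: $T_G(x,y)=\min\{x,y\}$; $T_L(x,y)=\max\{0,x+y-1\}$; $T_P(x,y)=xy$; $T_{NM}(x,y)=\min\{x,y\}$ if $x+y>1$ and $0$ if $x+y\le 1$; $T_D(x,y)=\min\{x,y\}$ if $\max\{x,y\}=1$ and $0$ if $\max\{x,y\}<1$. The order symbol is interpreted by the usual order and the constants by the corresponding rationals. The universe of ${}^{\ast}M$ is ${}^{\ast}[0,1]=[0,1]^{\mathbb N}/\mathcal V$, regarded as a subset of ${}^{\ast}\mathbb R=\mathbb R^{\mathbb N}/\mathcal V$. The endpoint monads are $\mu^-(1)=\{\xi\in{}^{\ast}[0,1]:0<1-\xi<\tfrac1n\text{ for every integer }n\ge2\}$ and $\mu^+(0)=\{\xi\in{}^{\ast}[0,1]:0<\xi<\tfrac1n\text{ for every integer }n\ge2\}$. *)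

theory Defs
  imports Complex_Main "HOL-Library.FuncSet" "HOL-Library.Countable_Set"
begin

section \<open>The language\<close>

typedef unit_rat = "{q :: rat. 0 \<le> q \<and> q \<le> 1}"
  by (intro exI[of _ 0]) simp

datatype tnorm = T_G | T_L | T_P | T_NM | T_D

text \<open>
  The type parameter is the set of constant symbols: the language \<open>L\<close> is the instance
  \<open>unit_rat\<close>, and the instance \<open>unit_rat + 'a\<close> provides in addition names for
  elements of a structure with carrier in \<open>'a\<close>, as needed for types over parameters.
  The automatically generated set functions collect the constants that occur.
\<close>

datatype (consts_tm: 'c) tm =
  Var nat | Const 'c | App tnorm "'c tm" "'c tm"

datatype (consts_fm: 'c) fm =
  Eq "'c tm" "'c tm" | Le "'c tm" "'c tm" | Neg "'c fm" | Conj "'c fm" "'c fm" | Ex nat "'c fm"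

primrec fv_tm :: "'c tm \<Rightarrow> nat set" where
  "fv_tm (Var i) = {i}"
| "fv_tm (Const c) = {}"
| "fv_tm (App T s t) = fv_tm s \<union> fv_tm t"

primrec fv :: "'c fm \<Rightarrow> nat set" where
  "fv (Eq s t) = fv_tm s \<union> fv_tm t"
| "fv (Le s t) = fv_tm s \<union> fv_tm t"
| "fv (Neg \<phi>) = fv \<phi>"
| "fv (Conj \<phi> \<psi>) = fv \<phi> \<union> fv \<psi>"
| "fv (Ex i \<phi>) = fv \<phi> - {i}"

section \<open>Structures and satisfaction\<close>

record ('c, 'a) struct =
  univ :: "'a set"
  cst :: "'c \<Rightarrow> 'a"
  opn :: "tnorm \<Rightarrow> 'a \<Rightarrow> 'a \<Rightarrow> 'a"
  leq :: "'a \<Rightarrow> 'a \<Rightarrow> bool"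

primrec val :: "('c, 'a) struct \<Rightarrow> (nat \<Rightarrow> 'a) \<Rightarrow> 'c tm \<Rightarrow> 'a" where
  "val A e (Var i) = e i"
| "val A e (Const c) = cst A c"
| "val A e (App T s t) = opn A T (val A e s) (val A e t)"

primrec sat :: "('c, 'a) struct \<Rightarrow> (nat \<Rightarrow> 'a) \<Rightarrow> 'c fm \<Rightarrow> bool" where
  "sat A e (Eq s t) \<longleftrightarrow> val A e s = val A e t"
| "sat A e (Le s t) \<longleftrightarrow> leq A (val A e s) (val A e t)"
| "sat A e (Neg \<phi>) \<longleftrightarrow> \<not> sat A e \<phi>"
| "sat A e (Conj \<phi> \<psi>) \<longleftrightarrow> sat A e \<phi> \<and> sat A e \<psi>"
| "sat A e (Ex i \<phi>) \<longleftrightarrow> (\<exists>a \<in> univ A. sat A (e(i := a)) \<phi>)"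

definition with_params :: "('c, 'a) struct \<Rightarrow> ('c + 'a, 'a) struct" where
  "with_params A =
     \<lparr>univ = univ A, cst = case_sum (cst A) (\<lambda>a. a), opn = opn A, leq = leq A\<rparr>"

text \<open>
  Every set of formulas in one free variable (here variable \<open>0\<close>) with parameters from a
  set of cardinality below \<open>\<aleph>\<^sub>1\<close> that is finitely satisfiable in \<open>A\<close> is
  realized in \<open>A\<close>.
\<close>

definition aleph1_saturated :: "('c, 'a) struct \<Rightarrow> bool" where
  "aleph1_saturated A \<longleftrightarrow>
     (\<forall>P \<Gamma>. P \<subseteq> univ A \<longrightarrow> countable P \<longrightarrow>
        (\<forall>\<phi> \<in> \<Gamma>. fv \<phi> \<subseteq> {0} \<and> consts_fm \<phi> \<subseteq> UNIV <+> P) \<longrightarrow>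
        (\<forall>\<Gamma>0. finite \<Gamma>0 \<longrightarrow> \<Gamma>0 \<subseteq> \<Gamma> \<longrightarrow>
           (\<exists>a \<in> univ A. \<forall>\<phi> \<in> \<Gamma>0. sat (with_params A) (\<lambda>_. a) \<phi>)) \<longrightarrow>
        (\<exists>a \<in> univ A. \<forall>\<phi> \<in> \<Gamma>. sat (with_params A) (\<lambda>_. a) \<phi>))"

section \<open>The structure on the unit interval\<close>

primrec tnorm_op :: "tnorm \<Rightarrow> real \<Rightarrow> real \<Rightarrow> real" where
  "tnorm_op T_G x y = min x y"
| "tnorm_op T_L x y = max 0 (x + y - 1)"
| "tnorm_op T_P x y = x * y"
| "tnorm_op T_NM x y = (if x + y > 1 then min x y else 0)"
| "tnorm_op T_D x y = (if max x y = 1 then min x y else 0)"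

definition unit_struct :: "(unit_rat, real) struct" where
  "unit_struct =
     \<lparr>univ = {0..1}, cst = (\<lambda>q. real_of_rat (Rep_unit_rat q)), opn = tnorm_op, leq = (\<le>)\<rparr>"

section \<open>Ultrapowers\<close>

definition ultrafilter :: "'i filter \<Rightarrow> bool" where
  "ultrafilter V \<longleftrightarrow>
     V \<noteq> bot \<and> (\<forall>P. eventually P V \<or> eventually (\<lambda>i. \<not> P i) V)"

definition nonprincipal :: "'i filter \<Rightarrow> bool" where
  "nonprincipal V \<longleftrightarrow> (\<forall>i. V \<noteq> principal {i})"

text \<open>
  Elements of an ultrapower are literally equivalence classes of sequences. The class of a
  sequence is taken among all sequences over the type \<open>'a\<close>, so that for a structure
  with universe \<open>U\<close> the ultrapower of \<open>U\<close> is a subset of the ultrapower of the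
  whole type; in particular the ultrapower of the unit interval is a subset of that of the reals.
\<close>

definition ucls :: "'i filter \<Rightarrow> ('i \<Rightarrow> 'a) \<Rightarrow> ('i \<Rightarrow> 'a) set" where
  "ucls V f = {g. eventually (\<lambda>i. g i = f i) V}"

definition uconst :: "'i filter \<Rightarrow> 'a \<Rightarrow> ('i \<Rightarrow> 'a) set" where
  "uconst V a = ucls V (\<lambda>_. a)"

definition ulift :: "'i filter \<Rightarrow> ('a \<Rightarrow> 'a \<Rightarrow> 'a)
    \<Rightarrow> ('i \<Rightarrow> 'a) set \<Rightarrow> ('i \<Rightarrow> 'a) set \<Rightarrow> ('i \<Rightarrow> 'a) set" where
  "ulift V F X Y = {h. \<exists>f \<in> X. \<exists>g \<in> Y. eventually (\<lambda>i. h i = F (f i) (g i)) V}"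

definition ulift_rel :: "'i filter \<Rightarrow> ('a \<Rightarrow> 'a \<Rightarrow> bool)
    \<Rightarrow> ('i \<Rightarrow> 'a) set \<Rightarrow> ('i \<Rightarrow> 'a) set \<Rightarrow> bool" where
  "ulift_rel V R X Y \<longleftrightarrow> (\<exists>f \<in> X. \<exists>g \<in> Y. eventually (\<lambda>i. R (f i) (g i)) V)"

definition ultrapower :: "'i filter \<Rightarrow> ('c, 'a) struct \<Rightarrow> ('c, ('i \<Rightarrow> 'a) set) struct" where
  "ultrapower V A =
     \<lparr>univ = ucls V ` (UNIV \<rightarrow> univ A),
      cst = (\<lambda>c. uconst V (cst A c)),
      opn = (\<lambda>T. ulift V (opn A T)),
      leq = ulift_rel V (leq A)\<rparr>"

section \<open>Endpoint monads\<close>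

text \<open>Subtraction and order below are those of the ultrapower of the reals.\<close>

definition monad_one :: "nat filter \<Rightarrow> (nat \<Rightarrow> real) set set" where
  "monad_one V = {\<xi> \<in> univ (ultrapower V unit_struct).
     ulift_rel V (<) (uconst V 0) (ulift V (-) (uconst V 1) \<xi>) \<and>
     (\<forall>n :: nat. n \<ge> 2 \<longrightarrow> ulift_rel V (<) (ulift V (-) (uconst V 1) \<xi>) (uconst V (1 / real n)))}"

definition monad_zero :: "nat filter \<Rightarrow> (nat \<Rightarrow> real) set set" where
  "monad_zero V = {\<xi> \<in> univ (ultrapower V unit_struct).
     ulift_rel V (<) (uconst V 0) \<xi> \<and>
     (\<forall>n :: nat. n \<ge> 2 \<longrightarrow> ulift_rel V (<) \<xi> (uconst V (1 / real n)))}"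

end

theory Submission
  imports Defs
begin

text \<open>
  The witnesses come from a diagonal construction. Since \<open>\<Sigma>\<close> is countable, it is the
  increasing union of finite sets \<open>\<Sigma>\<^sub>0 \<subseteq> \<Sigma>\<^sub>1 \<subseteq> \<dots>\<close>; for each \<open>k\<close> the hypothesis
  provides a tuple \<open>a\<^sub>k\<close> that satisfies \<open>\<Sigma>\<^sub>k\<close> and whose coordinates have distance
  less than \<open>1 / (k + 2)\<close> from the endpoint. Let \<open>\<xi>\<^sub>i\<close> be the class of the
  sequence of the \<open>i\<close>-th coordinates of the tuples \<open>a\<^sub>k\<close>.

  A non-principal ultrafilter on \<open>\<nat>\<close> contains every cofinite set
  (\<open>nonprincipal_ultrafilter_le_sequentially\<close>), so whatever holds for all large \<open>k\<close>
  holds \<open>V\<close>-almost everywhere. Each \<open>\<phi> \<in> \<Sigma>\<close> lies in \<open>\<Sigma>\<^sub>k\<close> for all large \<open>k\<close>,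
  hence \<open>\<phi>\<close> holds at \<open>V\<close>-almost all \<open>a\<^sub>k\<close> and, by the theorem of
  Los (\<open>sat_ultrapower_iff\<close>), at \<open>\<xi>\<close>. Likewise \<open>1 / (k + 2) < 1 / n\<close> for
  all large \<open>k\<close>, which puts each \<open>\<xi>\<^sub>i\<close> into the monad.

  The diagonal sequence realizes the whole type at once, in all \<open>m\<close> variables; it is in
  effect the proof that ultrapowers over \<open>\<nat>\<close> realize countable types, with the endpoint
  condition carried along by the choice of the tuples and not by additional formulas.
\<close>

section \<open>Operations and relations on classes of sequences\<close>

lemma mem_ucls_self: "f \<in> ucls V f"
  by (simp add: ucls_def)

lemma ucls_eq_iff: "ucls V f = ucls V g \<longleftrightarrow> eventually (\<lambda>i. f i = g i) V"
proof
  assume "ucls V f = ucls V g"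
  then have "f \<in> ucls V g" using mem_ucls_self by metis
  then show "eventually (\<lambda>i. f i = g i) V" by (simp add: ucls_def)
next
  assume fg: "eventually (\<lambda>i. f i = g i) V"
  have "eventually (\<lambda>i. h i = f i) V \<longleftrightarrow> eventually (\<lambda>i. h i = g i) V" for h
    by (rule eventually_cong[OF fg]) simp
  then show "ucls V f = ucls V g" by (simp add: ucls_def)
qed

lemma ulift_ucls: "ulift V F (ucls V f) (ucls V g) = ucls V (\<lambda>i. F (f i) (g i))"
proof (intro set_eqI iffI)
  fix h assume "h \<in> ulift V F (ucls V f) (ucls V g)"
  then obtain f' g' where
    "eventually (\<lambda>i. f' i = f i) V" "eventually (\<lambda>i. g' i = g i) V"
    "eventually (\<lambda>i. h i = F (f' i) (g' i)) V"
    by (auto simp: ulift_def ucls_def)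
  then have "eventually (\<lambda>i. h i = F (f i) (g i)) V"
    by eventually_elim simp
  then show "h \<in> ucls V (\<lambda>i. F (f i) (g i))" by (simp add: ucls_def)
next
  fix h assume "h \<in> ucls V (\<lambda>i. F (f i) (g i))"
  then show "h \<in> ulift V F (ucls V f) (ucls V g)"
    using mem_ucls_self[of f V] mem_ucls_self[of g V]
    by (auto simp: ulift_def ucls_def[of V "\<lambda>i. F (f i) (g i)"])
qed

lemma ulift_rel_ucls:
  "ulift_rel V R (ucls V f) (ucls V g) \<longleftrightarrow> eventually (\<lambda>i. R (f i) (g i)) V"
proof
  assume "ulift_rel V R (ucls V f) (ucls V g)"
  then obtain f' g' where
    "eventually (\<lambda>i. f' i = f i) V" "eventually (\<lambda>i. g' i = g i) V"
    "eventually (\<lambda>i. R (f' i) (g' i)) V"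
    by (auto simp: ulift_rel_def ucls_def)
  then show "eventually (\<lambda>i. R (f i) (g i)) V"
    by eventually_elim simp
next
  assume "eventually (\<lambda>i. R (f i) (g i)) V"
  then show "ulift_rel V R (ucls V f) (ucls V g)"
    using mem_ucls_self[of f V] mem_ucls_self[of g V] by (auto simp: ulift_rel_def)
qed

section \<open>Ultrafilters\<close>

lemma ultrafilter_eventually_not:
  assumes "ultrafilter V"
  shows "eventually (\<lambda>i. \<not> P i) V \<longleftrightarrow> \<not> eventually P V"
proof
  assume n: "eventually (\<lambda>i. \<not> P i) V"
  show "\<not> eventually P V"
  proof
    assume "eventually P V"
    with n have "eventually (\<lambda>i. False) V" by eventually_elim simp
    then show False using assms by (simp add: ultrafilter_def eventually_False)
  qed
qed (use assms in \<open>auto simp: ultrafilter_def\<close>)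

text \<open>
  An ultrafilter that does not contain the complement of \<open>{i}\<close> contains \<open>{i}\<close>, and a
  proper filter containing \<open>{i}\<close> is the principal one.
\<close>

lemma nonprincipal_ultrafilter_le_sequentially:
  fixes V :: "nat filter"
  assumes V: "ultrafilter V" and np: "nonprincipal V"
  shows "V \<le> sequentially"
proof -
  have ne: "eventually (\<lambda>n. n \<noteq> i) V" for i
  proof (rule ccontr)
    assume "\<not> eventually (\<lambda>n. n \<noteq> i) V"
    then have i: "eventually (\<lambda>n. n = i) V"
      using V by (simp add: ultrafilter_eventually_not)
    have "eventually P V \<longleftrightarrow> P i" for P
    proof -
      have "eventually P V \<longleftrightarrow> eventually (\<lambda>n. P i) V"
        by (rule eventually_cong[OF i]) simp
      also have "\<dots> \<longleftrightarrow> P i"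
        using V by (simp add: ultrafilter_def)
      finally show ?thesis .
    qed
    then have "V = principal {i}"
      by (simp add: filter_eq_iff eventually_principal)
    then show False using np by (simp add: nonprincipal_def)
  qed
  have "eventually (\<lambda>n. N \<le> n) V" for N
  proof -
    have "eventually (\<lambda>n. \<forall>i\<in>{..<N}. n \<noteq> i) V"
      using ne by (intro eventually_ball_finite) auto
    then show ?thesis by eventually_elim (metis lessThan_iff not_le)
  qed
  then show ?thesis
    unfolding le_filter_def eventually_sequentially using eventually_mono by blast
qed

section \<open>The theorem of Los\<close>

text \<open>
  The environment \<open>E\<close> is tied to the sequences \<open>e\<close> on the free variables only, so that
  an extensional tuple can serve as \<open>E\<close> whatever its default value is.
\<close>

lemma val_ultrapower:
  assumes "\<forall>i \<in> fv_tm t. E i = ucls V (e i)"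
  shows "val (ultrapower V A) E t = ucls V (\<lambda>n. val A (\<lambda>i. e i n) t)"
  using assms
  by (induction t) (auto simp: ultrapower_def uconst_def ulift_ucls)

text \<open>
  The ultrafilter property is what carries negation through the induction. In the existential
  case, indexwise witnesses are collected by choice into one sequence; at the negligible set of
  indices without a witness that sequence takes any value in the universe.
\<close>

theorem sat_ultrapower_iff:
  assumes V: "ultrafilter V" and "\<forall>i \<in> fv \<phi>. E i = ucls V (e i)"
  shows "sat (ultrapower V A) E \<phi> \<longleftrightarrow> eventually (\<lambda>n. sat A (\<lambda>i. e i n) \<phi>) V"
  using assms(2)
proof (induction \<phi> arbitrary: E e)
  case (Eq s t)
  then have "val (ultrapower V A) E s = ucls V (\<lambda>n. val A (\<lambda>i. e i n) s)"
    "val (ultrapower V A) E t = ucls V (\<lambda>n. val A (\<lambda>i. e i n) t)"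
    by (simp_all add: val_ultrapower)
  then show ?case by (simp add: ucls_eq_iff)
next
  case (Le s t)
  then have "val (ultrapower V A) E s = ucls V (\<lambda>n. val A (\<lambda>i. e i n) s)"
    "val (ultrapower V A) E t = ucls V (\<lambda>n. val A (\<lambda>i. e i n) t)"
    by (simp_all add: val_ultrapower)
  moreover have "leq (ultrapower V A) = ulift_rel V (leq A)"
    by (simp add: ultrapower_def)
  ultimately show ?case by (simp add: ulift_rel_ucls)
next
  case (Neg \<phi>)
  then show ?case using V by (simp add: ultrafilter_eventually_not)
next
  case (Conj \<phi> \<psi>)
  have "sat (ultrapower V A) E \<phi> \<longleftrightarrow> eventually (\<lambda>n. sat A (\<lambda>i. e i n) \<phi>) V"
    "sat (ultrapower V A) E \<psi> \<longleftrightarrow> eventually (\<lambda>n. sat A (\<lambda>i. e i n) \<psi>) V"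
    using Conj.prems by (auto intro!: Conj.IH)
  then show ?case by (simp add: eventually_conj_iff)
next
  case (Ex j \<phi>)
  have IH: "sat (ultrapower V A) (E(j := ucls V f)) \<phi> \<longleftrightarrow>
      eventually (\<lambda>n. sat A ((\<lambda>i. e i n)(j := f n)) \<phi>) V" for f
  proof -
    have "(\<lambda>i. (e(j := f)) i n) = (\<lambda>i. e i n)(j := f n)" for n
      by auto
    moreover have "\<forall>i \<in> fv \<phi>. (E(j := ucls V f)) i = ucls V ((e(j := f)) i)"
      using Ex.prems by auto
    ultimately show ?thesis
      using Ex.IH[of "E(j := ucls V f)" "e(j := f)"] by (simp only:)
  qed
  have "sat (ultrapower V A) E (fm.Ex j \<phi>) \<longleftrightarrow>
      (\<exists>f \<in> UNIV \<rightarrow> univ A. eventually (\<lambda>n. sat A ((\<lambda>i. e i n)(j := f n)) \<phi>) V)"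
    unfolding IH[symmetric] by (simp add: ultrapower_def)
  also have "\<dots> \<longleftrightarrow> eventually (\<lambda>n. \<exists>a \<in> univ A. sat A ((\<lambda>i. e i n)(j := a)) \<phi>) V"
  proof
    assume "\<exists>f \<in> UNIV \<rightarrow> univ A. eventually (\<lambda>n. sat A ((\<lambda>i. e i n)(j := f n)) \<phi>) V"
    then obtain f where f: "f \<in> UNIV \<rightarrow> univ A"
      and ev: "eventually (\<lambda>n. sat A ((\<lambda>i. e i n)(j := f n)) \<phi>) V" by blast
    from ev show "eventually (\<lambda>n. \<exists>a \<in> univ A. sat A ((\<lambda>i. e i n)(j := a)) \<phi>) V"
      by eventually_elim (use f in auto)
  next
    assume ev: "eventually (\<lambda>n. \<exists>a \<in> univ A. sat A ((\<lambda>i. e i n)(j := a)) \<phi>) V"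
    have "V \<noteq> bot" using V by (simp add: ultrafilter_def)
    with ev obtain b where b: "b \<in> univ A"
      using eventually_happens by blast
    have "\<forall>n. \<exists>b \<in> univ A. (\<exists>a \<in> univ A. sat A ((\<lambda>i. e i n)(j := a)) \<phi>)
        \<longrightarrow> sat A ((\<lambda>i. e i n)(j := b)) \<phi>"
      using b by blast
    then obtain f where f: "\<And>n. f n \<in> univ A"
      "\<And>n. (\<exists>a \<in> univ A. sat A ((\<lambda>i. e i n)(j := a)) \<phi>)
        \<Longrightarrow> sat A ((\<lambda>i. e i n)(j := f n)) \<phi>"
      by metis
    from ev have "eventually (\<lambda>n. sat A ((\<lambda>i. e i n)(j := f n)) \<phi>) V"
      by eventually_elim (rule f(2))
    then show "\<exists>f \<in> UNIV \<rightarrow> univ A. eventually (\<lambda>n. sat A ((\<lambda>i. e i n)(j := f n)) \<phi>) V"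
      using f(1) by blast
  qed
  finally show ?case by simp
qed

section \<open>Diagonal realization of a countable type\<close>

text \<open>
  The sets \<open>B k\<close> stand for a shrinking family of neighbourhoods. The conclusion exposes
  the representing sequences, so that membership of their classes in a monad can be read off from
  \<open>x i k \<in> B k\<close>.
\<close>

lemma countable_type_realized_along_sets:
  fixes V :: "nat filter" and A :: "('c, 'a) struct" and B :: "nat \<Rightarrow> 'a set"
  assumes V: "ultrafilter V" "V \<le> sequentially"
    and "countable \<Sigma>" and fv: "\<forall>\<phi> \<in> \<Sigma>. fv \<phi> \<subseteq> I"
    and fin_sat: "\<forall>\<Sigma>0 k. finite \<Sigma>0 \<longrightarrow> \<Sigma>0 \<subseteq> \<Sigma> \<longrightarrow>
      (\<exists>a \<in> I \<rightarrow> B k. \<forall>\<phi> \<in> \<Sigma>0. sat A a \<phi>)"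
  shows "\<exists>x. (\<forall>i \<in> I. \<forall>k. x i k \<in> B k) \<and>
    (\<forall>\<phi> \<in> \<Sigma>. sat (ultrapower V A) (\<lambda>i \<in> I. ucls V (x i)) \<phi>)"
proof -
  define S where "S k = {\<phi> \<in> \<Sigma>. to_nat_on \<Sigma> \<phi> \<le> k}" for k
  have "finite (S k)" for k
  proof (rule inj_on_finite)
    show "inj_on (to_nat_on \<Sigma>) (S k)"
      using inj_on_to_nat_on[OF \<open>countable \<Sigma>\<close>] by (rule inj_on_subset) (auto simp: S_def)
    show "to_nat_on \<Sigma> ` S k \<subseteq> {..k}" by (auto simp: S_def)
  qed simp
  then have "\<forall>k. \<exists>a \<in> I \<rightarrow> B k. \<forall>\<phi> \<in> S k. sat A a \<phi>"
    using fin_sat unfolding S_def by blast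
  then obtain a where a: "\<And>k. a k \<in> I \<rightarrow> B k" "\<And>k \<phi>. \<phi> \<in> S k \<Longrightarrow> sat A (a k) \<phi>"
    by metis
  show ?thesis
  proof (intro exI[of _ "\<lambda>i k. a k i"] conjI)
    show "\<forall>i \<in> I. \<forall>k. a k i \<in> B k"
      using a(1) by blast
    show "\<forall>\<phi> \<in> \<Sigma>. sat (ultrapower V A) (\<lambda>i \<in> I. ucls V (\<lambda>k. a k i)) \<phi>"
    proof
      fix \<phi> assume \<phi>: "\<phi> \<in> \<Sigma>"
      have "\<forall>i \<in> fv \<phi>. (\<lambda>i \<in> I. ucls V (\<lambda>k. a k i)) i = ucls V (\<lambda>k. a k i)"
        using fv \<phi> by auto
      note los = sat_ultrapower_iff[OF V(1), where e = "\<lambda>i k. a k i", OF this]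
      have "eventually (\<lambda>k. to_nat_on \<Sigma> \<phi> \<le> k) V"
        using V(2) eventually_ge_at_top by (rule filter_leD)
      then have "eventually (\<lambda>k. sat A (\<lambda>i. a k i) \<phi>) V"
        by eventually_elim (use a(2) \<phi> in \<open>auto simp: S_def\<close>)
      then show "sat (ultrapower V A) (\<lambda>i \<in> I. ucls V (\<lambda>k. a k i)) \<phi>"
        by (rule los[THEN iffD2])
    qed
  qed
qed

section \<open>Sequences converging to an endpoint\<close>

lemma inverse_plus_two_less:
  assumes "V \<le> sequentially" and "n \<ge> (2 :: nat)"
  shows "eventually (\<lambda>k. 1 / real (k + 2) < 1 / real n) V"
proof -
  have "eventually (\<lambda>k. n \<le> k) V"
    using assms(1) eventually_ge_at_top by (rule filter_leD)
  then show ?thesis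
    by eventually_elim (use assms(2) in \<open>auto intro!: divide_strict_left_mono\<close>)
qed

lemma ucls_in_monad_one:
  assumes V: "V \<le> sequentially" and x: "\<And>k. x k \<in> {1 - 1 / real (k + 2)<..<1}"
  shows "ucls V x \<in> monad_one V"
proof -
  have "eventually (\<lambda>k. 1 - x k < 1 / real n) V" if "n \<ge> 2" for n
    using inverse_plus_two_less[OF V that]
  proof eventually_elim
    case (elim k)
    then show ?case using x[of k] by simp
  qed
  moreover have "x k \<in> {0..1}" for k
  proof -
    have "1 / real (k + 2) \<le> 1" by simp
    then show ?thesis using x[of k] unfolding greaterThanLessThan_iff atLeastAtMost_iff by linarith
  qed
  moreover have "0 < 1 - x k" for k using x[of k] by simp
  ultimately show ?thesis
    by (auto simp: monad_one_def uconst_def ulift_ucls ulift_rel_ucls ultrapower_def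
        unit_struct_def)
qed

lemma ucls_in_monad_zero:
  assumes V: "V \<le> sequentially" and x: "\<And>k. x k \<in> {0<..<1 / real (k + 2)}"
  shows "ucls V x \<in> monad_zero V"
proof -
  have "eventually (\<lambda>k. x k < 1 / real n) V" if "n \<ge> 2" for n
    using inverse_plus_two_less[OF V that]
  proof eventually_elim
    case (elim k)
    then show ?case using x[of k] by simp
  qed
  moreover have "x k \<in> {0..1}" for k
  proof -
    have "1 / real (k + 2) \<le> 1" by simp
    then show ?thesis using x[of k] unfolding greaterThanLessThan_iff atLeastAtMost_iff by linarith
  qed
  moreover have "0 < x k" for k using x[of k] by simp
  ultimately show ?thesis
    by (auto simp: monad_zero_def uconst_def ulift_rel_ucls ultrapower_def unit_struct_def)
qed

section \<open>Realization in the endpoint monads\<close>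

text \<open>
  Both halves apply the diagonal construction to the intervals with bound \<open>1 / (k + 2)\<close>;
  the shift by two keeps the bound at index \<open>k = 0\<close> within the range \<open>k \<ge> 2\<close> of the
  hypothesis.
\<close>

theorem theorem7p9:
  fixes V :: "nat filter" and \<Sigma> :: "unit_rat fm set" and m :: nat
  assumes "ultrafilter V" and "nonprincipal V"
    and "aleph1_saturated (ultrapower V unit_struct)"
    and "countable \<Sigma>" and "\<forall>\<phi> \<in> \<Sigma>. fv \<phi> \<subseteq> {1..m}"
  shows "((\<forall>\<Sigma>0 (k :: nat). finite \<Sigma>0 \<longrightarrow> \<Sigma>0 \<subseteq> \<Sigma> \<longrightarrow> k \<ge> 2 \<longrightarrow>
            (\<exists>a \<in> {1..m} \<rightarrow>\<^sub>E {1 - 1 / real k<..<1}. \<forall>\<phi> \<in> \<Sigma>0. sat unit_struct a \<phi>)) \<longrightarrow>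
          (\<exists>\<xi> \<in> {1..m} \<rightarrow>\<^sub>E monad_one V. \<forall>\<phi> \<in> \<Sigma>. sat (ultrapower V unit_struct) \<xi> \<phi>)) \<and>
         ((\<forall>\<Sigma>0 (k :: nat). finite \<Sigma>0 \<longrightarrow> \<Sigma>0 \<subseteq> \<Sigma> \<longrightarrow> k \<ge> 2 \<longrightarrow>
            (\<exists>a \<in> {1..m} \<rightarrow>\<^sub>E {0<..<1 / real k}. \<forall>\<phi> \<in> \<Sigma>0. sat unit_struct a \<phi>)) \<longrightarrow>
          (\<exists>\<xi> \<in> {1..m} \<rightarrow>\<^sub>E monad_zero V. \<forall>\<phi> \<in> \<Sigma>. sat (ultrapower V unit_struct) \<xi> \<phi>))"
proof -
  have le: "V \<le> sequentially"
    using assms(1,2) by (rule nonprincipal_ultrafilter_le_sequentially)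
  show ?thesis
  proof (intro conjI impI)
    assume H: "\<forall>\<Sigma>0 (k :: nat). finite \<Sigma>0 \<longrightarrow> \<Sigma>0 \<subseteq> \<Sigma> \<longrightarrow> k \<ge> 2 \<longrightarrow>
      (\<exists>a \<in> {1..m} \<rightarrow>\<^sub>E {1 - 1 / real k<..<1}. \<forall>\<phi> \<in> \<Sigma>0. sat unit_struct a \<phi>)"
    have "\<forall>\<Sigma>0 k. finite \<Sigma>0 \<longrightarrow> \<Sigma>0 \<subseteq> \<Sigma> \<longrightarrow>
        (\<exists>a \<in> {1..m} \<rightarrow> {1 - 1 / real (k + 2)<..<1}. \<forall>\<phi> \<in> \<Sigma>0. sat unit_struct a \<phi>)"
    proof (intro allI impI)
      fix \<Sigma>0 :: "unit_rat fm set" and k :: nat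
      assume "finite \<Sigma>0" "\<Sigma>0 \<subseteq> \<Sigma>"
      from H[rule_format, OF this, of "k + 2"]
      show "\<exists>a \<in> {1..m} \<rightarrow> {1 - 1 / real (k + 2)<..<1}. \<forall>\<phi> \<in> \<Sigma>0. sat unit_struct a \<phi>"
        by (auto simp: PiE_def)
    qed
    from countable_type_realized_along_sets[
        where B = "\<lambda>k. {1 - 1 / real (k + 2)<..<1}", OF assms(1) le assms(4,5) this]
    obtain x where x: "\<forall>i \<in> {1..m}. \<forall>k. x i k \<in> {1 - 1 / real (k + 2)<..<1}"
      "\<forall>\<phi> \<in> \<Sigma>. sat (ultrapower V unit_struct) (\<lambda>i \<in> {1..m}. ucls V (x i)) \<phi>"
      by (elim exE conjE)
    have "(\<lambda>i \<in> {1..m}. ucls V (x i)) \<in> {1..m} \<rightarrow>\<^sub>E monad_one V"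
    proof (rule restrict_PiE_iff[THEN iffD2, rule_format])
      show "ucls V (x i) \<in> monad_one V" if "i \<in> {1..m}" for i
        by (rule ucls_in_monad_one[OF le x(1)[rule_format, OF that]])
    qed
    with x(2) show "\<exists>\<xi> \<in> {1..m} \<rightarrow>\<^sub>E monad_one V.
        \<forall>\<phi> \<in> \<Sigma>. sat (ultrapower V unit_struct) \<xi> \<phi>" by blast
  next
    assume H: "\<forall>\<Sigma>0 (k :: nat). finite \<Sigma>0 \<longrightarrow> \<Sigma>0 \<subseteq> \<Sigma> \<longrightarrow> k \<ge> 2 \<longrightarrow>
      (\<exists>a \<in> {1..m} \<rightarrow>\<^sub>E {0<..<1 / real k}. \<forall>\<phi> \<in> \<Sigma>0. sat unit_struct a \<phi>)"
    have "\<forall>\<Sigma>0 k. finite \<Sigma>0 \<longrightarrow> \<Sigma>0 \<subseteq> \<Sigma> \<longrightarrow>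
        (\<exists>a \<in> {1..m} \<rightarrow> {0<..<1 / real (k + 2)}. \<forall>\<phi> \<in> \<Sigma>0. sat unit_struct a \<phi>)"
    proof (intro allI impI)
      fix \<Sigma>0 :: "unit_rat fm set" and k :: nat
      assume "finite \<Sigma>0" "\<Sigma>0 \<subseteq> \<Sigma>"
      from H[rule_format, OF this, of "k + 2"]
      show "\<exists>a \<in> {1..m} \<rightarrow> {0<..<1 / real (k + 2)}. \<forall>\<phi> \<in> \<Sigma>0. sat unit_struct a \<phi>"
        by (auto simp: PiE_def)
    qed
    from countable_type_realized_along_sets[
        where B = "\<lambda>k. {0<..<1 / real (k + 2)}", OF assms(1) le assms(4,5) this]
    obtain x where x: "\<forall>i \<in> {1..m}. \<forall>k. x i k \<in> {0<..<1 / real (k + 2)}"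
      "\<forall>\<phi> \<in> \<Sigma>. sat (ultrapower V unit_struct) (\<lambda>i \<in> {1..m}. ucls V (x i)) \<phi>"
      by (elim exE conjE)
    have "(\<lambda>i \<in> {1..m}. ucls V (x i)) \<in> {1..m} \<rightarrow>\<^sub>E monad_zero V"
    proof (rule restrict_PiE_iff[THEN iffD2, rule_format])
      show "ucls V (x i) \<in> monad_zero V" if "i \<in> {1..m}" for i
        by (rule ucls_in_monad_zero[OF le x(1)[rule_format, OF that]])
    qed
    with x(2) show "\<exists>\<xi> \<in> {1..m} \<rightarrow>\<^sub>E monad_zero V.
        \<forall>\<phi> \<in> \<Sigma>. sat (ultrapower V unit_struct) \<xi> \<phi>" by blast
  qed
qed

end
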